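(* Suppose $m \geq 2$ is even, and let $\mathcal{E}=\{2,4,\dots,m\}$. Two $m$-edge-coloured graphs $G$ and $H$ with the same underlying graph are switch equivalent with respect to $D_m$ if and only if they have the same collection of cycles for which the number of edges whose colour is in $\mathcal{E}$ is odd.
   Context: Graphs are finite, undirected and simple. An $m$-edge-coloured graph is a pair $G=(F,\Sigma)$ where $F$ is a graph, called the underlying graph of $G$, and $\Sigma: E(F)\to\{1,\dots,m\}$ is a function; $\Sigma(e)$ is the colour of the edge $e$, and we write $\Sigma(G)=\Sigma$. An isomorphism of $m$-edge-coloured graphs is an isomorphism of the underlying graphs that preserves edge colours. For $m\ge 3$, $D_m$ is the group of permutations of $\{1,\dots,m\}$ corresponding to symmetries of the regular $m$-gon with vertices $1,2,\dots,m$ in cyclic order; $D_2=S_2$, the symmetric group on $\{1,2\}$. For a vertex $x$ of $G$ and $\pi\in D_m$, switching at $x$ with respect to $\pi$ transforms $G$ into the $m$-edge-coloured graph $G^{(x,\pi)}$ with the same underlying graph, in which each edge $xy$ incident with $x$ has colour $\pi(\Sigma(G)(xy))$ and all other edges keep their colours. A $D_m$-switching sequence is a finite sequence $\mathcal{S}=(x_1,\pi_1),\dots,(x_t,\pi_t)$ of elements of $V(G)\times D_m$, and $G^{\mathcal{S}}$ is the result of performing these switches successively in order. $G$ and $H$ are switch equivalent with respect to $D_m$ if there is a $D_m$-switching sequence $\mathcal{S}$ such that $G^{\mathcal{S}}$ is isomorphic to $H$.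
   Formalization: "Only if" fails literally (two disjoint triangles, m=2). Proved instead: switching turns G into H itself iff the collections of cycles are equal; G and H are switch equivalent up to isomorphism iff an automorphism of the underlying graph maps one collection to the other. *)

theory Defs
  imports Complex_Main "HOL-Combinatorics.Permutations"
begin

record 'a graph =
  verts :: "'a set"
  edges :: "'a set set"

definition simple_graph :: "'a graph \<Rightarrow> bool" where
  "simple_graph F \<longleftrightarrow> finite (verts F) \<and> (\<forall>e\<in>edges F. e \<subseteq> verts F \<and> card e = 2)"

definition graph_iso :: "('a \<Rightarrow> 'b) \<Rightarrow> 'a graph \<Rightarrow> 'b graph \<Rightarrow> bool" where
  "graph_iso f F F' \<longleftrightarrow> bij_betw f (verts F) (verts F') \<and>
     (\<forall>x\<in>verts F. \<forall>y\<in>verts F. {x, y} \<in> edges F \<longleftrightarrow> {f x, f y} \<in> edges F')"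

text \<open>The colouring is a total function on vertex sets; only its values on the edges of the
  underlying graph carry meaning.\<close>

record 'a ec_graph =
  underlying :: "'a graph"
  colour :: "'a set \<Rightarrow> nat"

definition edge_coloured :: "nat \<Rightarrow> 'a ec_graph \<Rightarrow> bool" where
  "edge_coloured m G \<longleftrightarrow> simple_graph (underlying G) \<and>
     (\<forall>e\<in>edges (underlying G). colour G e \<in> {1..m})"

definition ec_iso :: "('a \<Rightarrow> 'b) \<Rightarrow> 'a ec_graph \<Rightarrow> 'b ec_graph \<Rightarrow> bool" where
  "ec_iso f G H \<longleftrightarrow> graph_iso f (underlying G) (underlying H) \<and>
     (\<forall>e\<in>edges (underlying G). colour H (f ` e) = colour G e)"

text \<open>The vertices of the regular polygon are the \<open>m\<close>-th roots of unity, numbered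
  \<open>1, \<dots>, m\<close> in cyclic order; its symmetries are the isometries of the plane that permute
  these vertices.\<close>

definition polygon_vertex :: "nat \<Rightarrow> nat \<Rightarrow> complex" where
  "polygon_vertex m i = cis (2 * pi * real i / real m)"

definition D :: "nat \<Rightarrow> (nat \<Rightarrow> nat) set" where
  "D m = (if m = 2 then {\<pi>. \<pi> permutes {1..2}}
          else {\<pi>. \<pi> permutes {1..m} \<and>
                  (\<exists>f :: complex \<Rightarrow> complex.
                     (\<forall>z w. dist (f z) (f w) = dist z w) \<and>
                     (\<forall>i\<in>{1..m}. f (polygon_vertex m i) = polygon_vertex m (\<pi> i)))})"

definition switch :: "'a \<times> (nat \<Rightarrow> nat) \<Rightarrow> 'a ec_graph \<Rightarrow> 'a ec_graph" where
  "switch = (\<lambda>(x, \<pi>) G.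
     G\<lparr>colour := (\<lambda>e. if x \<in> e then \<pi> (colour G e) else colour G e)\<rparr>)"

definition switches :: "'a ec_graph \<Rightarrow> ('a \<times> (nat \<Rightarrow> nat)) list \<Rightarrow> 'a ec_graph" where
  "switches G S = fold switch S G"

definition switching_sequence :: "nat \<Rightarrow> 'a ec_graph \<Rightarrow> ('a \<times> (nat \<Rightarrow> nat)) list \<Rightarrow> bool" where
  "switching_sequence m G S \<longleftrightarrow> set S \<subseteq> verts (underlying G) \<times> D m"

definition switch_equivalent :: "nat \<Rightarrow> 'a ec_graph \<Rightarrow> 'b ec_graph \<Rightarrow> bool" where
  "switch_equivalent m G H \<longleftrightarrow>
     (\<exists>S. switching_sequence m G S \<and> (\<exists>f. ec_iso f (switches G S) H))"

text \<open>For graphs on the same vertices: switching turns \<open>G\<close> into \<open>H\<close> itself, that is, the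
  isomorphism is the identity. An arbitrary isomorphism may permute the cycles of the underlying
  graph, so only this version can determine the set of cycles with an odd number of edges of even
  colour; \<^const>\<open>switch_equivalent\<close> determines it up to an automorphism of the underlying
  graph.\<close>

definition labelled_switch_equivalent :: "nat \<Rightarrow> 'a ec_graph \<Rightarrow> 'a ec_graph \<Rightarrow> bool" where
  "labelled_switch_equivalent m G H \<longleftrightarrow>
     (\<exists>S. switching_sequence m G S \<and> ec_iso id (switches G S) H)"

text \<open>A cycle is represented by its edge set, which determines it as a subgraph.\<close>

definition is_cycle :: "'a graph \<Rightarrow> 'a set set \<Rightarrow> bool" where
  "is_cycle F C \<longleftrightarrow> C \<subseteq> edges F \<and>
     (\<exists>p. distinct p \<and> length p \<ge> 3 \<and>
          C = {{p ! i, p ! (Suc i mod length p)} | i. i < length p})"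

definition even_colours :: "nat \<Rightarrow> nat set" where
  "even_colours m = {i \<in> {1..m}. even i}"

definition odd_cycles :: "nat \<Rightarrow> 'a ec_graph \<Rightarrow> 'a set set set" where
  "odd_cycles m G = {C. is_cycle (underlying G) C \<and>
     odd (card {e \<in> C. colour G e \<in> even_colours m})}"

text \<open>A vertex map acts on cycles through its action on edges.\<close>

definition map_cycle :: "('a \<Rightarrow> 'b) \<Rightarrow> 'a set set \<Rightarrow> 'b set set" where
  "map_cycle f C = (\<lambda>e. f ` e) ` C"

end

theory Submission
  imports Defs
begin

text \<open>
  Work with the parity of each colour instead of the colour itself. When \<open>m\<close> is even, the vertices
  of the \<open>m\<close>-gon alternate between odd and even numbers around the polygon, and a symmetry maps
  neighbours to neighbours; so every element of \<open>D m\<close> either preserves all parities or reverses all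
  of them (lemma \<open>D_parity\<close>). A switch at \<open>x\<close> thus changes the parities either on no edge or on all
  edges at \<open>x\<close>, and a sequence of switches changes them exactly on the edges of a cut, the edges
  with one end in some vertex set \<open>X\<close>; every cut arises in this way.

  Conversely, parities are all that is invariant. Switching alternately with two reflections \<open>\<rho>\<close>
  at \<open>x\<close> and \<open>\<sigma>\<close> at \<open>y\<close>, in the order \<open>\<rho>, \<sigma>, \<rho>, \<sigma>\<close>, applies \<open>\<rho>\<^sup>2\<close> or \<open>\<sigma>\<^sup>2\<close>, the identity, to the
  edges that meet only one of \<open>x\<close> and \<open>y\<close>, but the commutator \<open>(\<sigma>\<rho>)\<^sup>2\<close> to the edge \<open>xy\<close>. For
  reflections in neighbouring axes this is the rotation by two steps, whose powers act transitively
  on the colours of each parity. Each edge can therefore be given any colour of the right parity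
  independently of the others (lemma \<open>recolour_edge\<close>), and \<open>G\<close> can be switched into \<open>H\<close> if and only
  if the set of edges on which their parities differ is a cut
  (lemma \<open>labelled_switch_equivalent_iff_cut\<close>).

  It remains to recognise cuts by cycles. A cut meets every cycle in an even number of edges; the
  converse is Harary's balance theorem for signed graphs (lemma \<open>balanced_imp_cut\<close>), proved by adding
  the edges one at a time. As the number of edges of a cycle on which \<open>G\<close> and \<open>H\<close> differ in parity
  has the parity of the sum of their numbers of evenly coloured edges, this settles labelled
  equivalence. Equivalence up to an isomorphism \<open>f\<close> reduces to the labelled case by pulling the
  colouring of \<open>H\<close> back along \<open>f\<close>.
\<close>

section \<open>Parities and cuts\<close>

lemma odd_card_Int_sym_diff:
  assumes "finite A"
  shows "odd (card (A \<inter> sym_diff X Y)) \<longleftrightarrow> (odd (card (A \<inter> X)) \<noteq> odd (card (A \<inter> Y)))"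
  using assms
proof (induction A)
  case (insert a A)
  have "card (insert a A \<inter> Z) = card (A \<inter> Z) + (if a \<in> Z then 1 else 0)" for Z
    using insert.hyps by (simp add: Int_insert_left)
  then show ?case using insert.IH by auto
qed simp

text \<open>
  Parity of cardinality is additive under symmetric difference; this is the additivity for sets
  given by predicates.
\<close>

lemma odd_card_filter_neq:
  assumes "finite C"
  shows "odd (card {x \<in> C. P x \<noteq> Q x}) \<longleftrightarrow>
         (odd (card {x \<in> C. P x}) \<noteq> odd (card {x \<in> C. Q x}))"
proof -
  have "{x \<in> C. P x \<noteq> Q x} = C \<inter> sym_diff {x. P x} {x. Q x}" by auto
  moreover have "{x \<in> C. R x} = C \<inter> {x. R x}" for R by auto
  ultimately show ?thesis using odd_card_Int_sym_diff[OF assms] by metis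
qed

lemma odd_card_doubleton_Int:
  assumes "x \<noteq> y"
  shows "odd (card ({x, y} \<inter> X)) \<longleftrightarrow> (x \<in> X) \<noteq> (y \<in> X)"
  using assms by (simp add: Int_insert_left)

text \<open>
  Used to go around a cycle: a truth value that returns to where it started has changed an even
  number of times.
\<close>

lemma even_card_changes:
  "even (card {i. i < n \<and> c i \<noteq> c (Suc i)}) \<longleftrightarrow> (c 0 \<longleftrightarrow> c (n::nat))"
proof (induction n)
  case (Suc n)
  have "{i. i < Suc n \<and> c i \<noteq> c (Suc i)} =
        {i. i < n \<and> c i \<noteq> c (Suc i)} \<union> (if c n \<noteq> c (Suc n) then {n} else {})"
    by (auto simp: less_Suc_eq)
  then show ?case using Suc by (auto simp: card_insert_if)
qed simp

definition cycle_edges :: "'a list \<Rightarrow> 'a set set" where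
  "cycle_edges p = {{p ! i, p ! (Suc i mod length p)} | i. i < length p}"

lemma cycle_edges_image:
  "cycle_edges p = (\<lambda>i. {p ! i, p ! (Suc i mod length p)}) ` {..<length p}"
  by (auto simp: cycle_edges_def)

lemma is_cycle_iff:
  "is_cycle F C \<longleftrightarrow>
     C \<subseteq> edges F \<and> (\<exists>p. distinct p \<and> length p \<ge> 3 \<and> C = cycle_edges p)"
  by (simp add: is_cycle_def cycle_edges_def)

lemma finite_cycle: "is_cycle F C \<Longrightarrow> finite C"
  unfolding is_cycle_iff cycle_edges_def by auto

text \<open>
  Counting the edges of a cycle by their positions is legitimate only from length three on: a
  closed walk of length two uses the same edge twice.
\<close>

lemma inj_on_cycle_edge:
  assumes "distinct p" "length p \<ge> 3"
  shows "inj_on (\<lambda>i. {p ! i, p ! (Suc i mod length p)}) {..<length p}"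
proof (rule inj_onI)
  fix i j
  assume ij: "i \<in> {..<length p}" "j \<in> {..<length p}"
    and eq: "{p ! i, p ! (Suc i mod length p)} = {p ! j, p ! (Suc j mod length p)}"
  have less: "Suc k mod length p < length p" for k
    using assms(2) by (intro mod_less_divisor) linarith
  from eq have "i = j \<or> i = Suc j mod length p \<and> Suc i mod length p = j"
    using ij less assms(1) by (auto simp: doubleton_eq_iff nth_eq_iff_index_eq)
  then show "i = j"
    using ij assms(2) by (auto simp: mod_Suc split: if_splits)
qed

text \<open>
  For an edge \<open>e\<close>, a two-element set, \<open>odd (card (e \<inter> X))\<close> says that exactly one end of \<open>e\<close> lies in
  \<open>X\<close>. This form of cut membership is additive in \<open>X\<close>. Walking around a cycle, one enters \<open>X\<close> as often
  as one leaves it.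
\<close>

lemma even_card_cycle_cut:
  assumes "is_cycle F C"
  shows "even (card {e \<in> C. odd (card (e \<inter> X))})"
proof -
  obtain p where p: "distinct p" "length p \<ge> 3" "C = cycle_edges p"
    using assms by (auto simp: is_cycle_iff)
  define n where "n = length p"
  define g where "g i = {p ! i, p ! (Suc i mod n)}" for i
  define c where "c i \<longleftrightarrow> p ! (i mod n) \<in> X" for i
  have C: "C = g ` {..<n}" by (simp add: p(3) cycle_edges_image g_def n_def)
  have inj: "inj_on g {..<n}"
    using inj_on_cycle_edge[OF p(1,2)] by (simp add: g_def n_def inj_on_def)
  have g: "odd (card (g i \<inter> X)) \<longleftrightarrow> c i \<noteq> c (Suc i)" if "i < n" for i
  proof -
    have "Suc i mod n \<noteq> i" "Suc i mod n < n"
      using that p(2) by (auto simp: mod_Suc n_def)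
    then have "p ! i \<noteq> p ! (Suc i mod n)"
      using that p(1) by (metis n_def nth_eq_iff_index_eq)
    then show ?thesis using that by (simp add: g_def c_def odd_card_doubleton_Int)
  qed
  have "{e \<in> C. odd (card (e \<inter> X))} = g ` {i. i < n \<and> c i \<noteq> c (Suc i)}"
    using g by (auto simp: C)
  moreover have "inj_on g {i. i < n \<and> c i \<noteq> c (Suc i)}"
    using inj by (rule inj_on_subset) auto
  ultimately have "card {e \<in> C. odd (card (e \<inter> X))} = card {i. i < n \<and> c i \<noteq> c (Suc i)}"
    by (simp add: card_image)
  moreover have "c 0 \<longleftrightarrow> c n" by (simp add: c_def)
  ultimately show ?thesis using even_card_changes[of n c] by simp
qed

section \<open>Balanced labellings are cuts\<close>

definition simple_path :: "'a set set \<Rightarrow> 'a list \<Rightarrow> bool" where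
  "simple_path E p \<longleftrightarrow>
     p \<noteq> [] \<and> distinct p \<and> (\<forall>i. Suc i < length p \<longrightarrow> {p ! i, p ! Suc i} \<in> E)"

definition path_component :: "'a set set \<Rightarrow> 'a \<Rightarrow> 'a set" where
  "path_component E a = {v. \<exists>p. simple_path E p \<and> hd p = a \<and> last p = v}"

lemma path_component_refl: "a \<in> path_component E a"
  unfolding path_component_def simple_path_def by (auto intro: exI[of _ "[a]"])

text \<open>
  A simple path to \<open>v\<close> either already visits the neighbour \<open>w\<close>, and is cut off there, or extends to
  \<open>w\<close> and remains simple.
\<close>

lemma path_component_step:
  assumes "v \<in> path_component E a" "{v, w} \<in> E"
  shows "w \<in> path_component E a"
proof -
  obtain p where p: "simple_path E p" "hd p = a" "last p = v"
    using assms(1) by (auto simp: path_component_def)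
  show ?thesis
  proof (cases "w \<in> set p")
    case True
    then obtain k where k: "k < length p" "p ! k = w" by (auto simp: in_set_conv_nth)
    have "simple_path E (take (Suc k) p)"
      using p(1) k by (auto simp: simple_path_def)
    moreover have "hd (take (Suc k) p) = a" using p(2) by simp
    moreover have "last (take (Suc k) p) = w" using k by (simp add: take_Suc_conv_app_nth)
    ultimately show ?thesis by (auto simp: path_component_def)
  next
    case False
    have "{(p @ [w]) ! i, (p @ [w]) ! Suc i} \<in> E" if "Suc i < length (p @ [w])" for i
    proof (cases "Suc i < length p")
      case True
      then show ?thesis using p(1) by (simp add: simple_path_def nth_append)
    next
      case False
      then have i: "Suc i = length p" using that by simp
      then have "p ! i = v"
        using p(1,3) by (metis diff_Suc_1 last_conv_nth simple_path_def)
      then show ?thesis using i assms(2) by (simp add: nth_append)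
    qed
    then have "simple_path E (p @ [w])"
      using p(1) False by (simp add: simple_path_def)
    moreover have "hd (p @ [w]) = a" using p(1,2) by (simp add: simple_path_def)
    ultimately show ?thesis by (force simp: path_component_def)
  qed
qed

text \<open>
  The path from \<open>a\<close> to \<open>b\<close> has at least three vertices because the edge \<open>ab\<close> is missing from \<open>E\<close>, so
  adding this edge produces a genuine cycle.
\<close>

lemma path_closes_to_cycle:
  assumes "b \<in> path_component E a" "a \<noteq> b" "{a, b} \<notin> E" "insert {a, b} E \<subseteq> edges F"
  shows "\<exists>C. is_cycle F C \<and> {a, b} \<in> C \<and> C \<subseteq> insert {a, b} E"
proof -
  obtain p where p: "simple_path E p" "hd p = a" "last p = b"
    using assms(1) by (auto simp: path_component_def)
  define n where "n = length p"
  have ne: "p \<noteq> []" and dist: "distinct p"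
    and step: "\<And>i. Suc i < n \<Longrightarrow> {p ! i, p ! Suc i} \<in> E"
    using p(1) by (auto simp: simple_path_def n_def)
  have a: "p ! 0 = a" using p(2) ne by (simp add: hd_conv_nth)
  have b: "p ! (n - 1) = b" using p(3) ne by (simp add: last_conv_nth n_def)
  have "n \<noteq> 0" using ne by (simp add: n_def)
  moreover have "n \<noteq> 1" using a b assms(2) by auto
  moreover have "n \<noteq> 2" using a b assms(3) step[of 0] by auto
  ultimately have n: "n \<ge> 3" by simp
  have mem: "{p ! i, p ! (Suc i mod n)} \<in> insert {a, b} E" if "i < n" for i
  proof (cases "Suc i < n")
    case False
    then have "i = n - 1" "Suc i = n" using that by auto
    then show ?thesis using a b by (auto simp: insert_commute)
  qed (use step in simp)
  then have sub: "cycle_edges p \<subseteq> insert {a, b} E"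
    by (auto simp: cycle_edges_def n_def)
  have "{p ! (n - 1), p ! (Suc (n - 1) mod n)} \<in> cycle_edges p"
    unfolding cycle_edges_def using n by (auto simp: n_def intro!: exI[of _ "length p - 1"])
  then have "{a, b} \<in> cycle_edges p" using a b n by (simp add: insert_commute)
  moreover have "is_cycle F (cycle_edges p)"
    using sub assms(4) dist n by (auto simp: is_cycle_iff n_def)
  ultimately show ?thesis using sub by blast
qed

text \<open>
  Let a cut \<open>X\<close> be found for the edges added so far, and let it be wrong on the new edge \<open>ab\<close>. If \<open>a\<close>
  and \<open>b\<close> were already connected, \<open>ab\<close> would close a cycle on which \<open>P\<close> differs from a cut on the
  single edge \<open>ab\<close>, so that \<open>P\<close> would hold on an odd number of its edges. Hence they lie in
  different components, and exchanging \<open>X\<close> with its complement on the component \<open>K\<close> of \<open>a\<close> corrects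
  \<open>ab\<close> and affects no other edge.
\<close>

lemma balanced_imp_cut:
  assumes "finite E" "\<And>e. e \<in> E \<Longrightarrow> card e = 2" "E \<subseteq> edges F"
    and "\<And>C. is_cycle F C \<Longrightarrow> even (card {e \<in> C. P e})"
  shows "\<exists>X. \<forall>e\<in>E. P e \<longleftrightarrow> odd (card (e \<inter> X))"
  using assms(1-3)
proof (induction E)
  case (insert e E)
  obtain X where X: "\<And>f. f \<in> E \<Longrightarrow> P f \<longleftrightarrow> odd (card (f \<inter> X))"
    using insert.IH insert.prems by auto
  obtain a b where e: "e = {a, b}" "a \<noteq> b"
    using insert.prems(1)[of e] by (auto simp: card_2_iff)
  show ?case
  proof (cases "P e \<longleftrightarrow> odd (card (e \<inter> X))")
    case True
    then show ?thesis using X by (intro exI[of _ X]) auto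
  next
    case False
    define K where "K = path_component E a"
    have "b \<notin> K"
    proof
      assume "b \<in> K"
      then obtain C where C: "is_cycle F C" "e \<in> C" "C \<subseteq> insert e E"
        using path_closes_to_cycle[of b E a F] e insert.hyps insert.prems(2)
        by (auto simp: K_def)
      have "{f \<in> C. P f \<noteq> odd (card (f \<inter> X))} = {e}" using C X False by auto
      then have "odd (card {f \<in> C. P f \<noteq> odd (card (f \<inter> X))})" by simp
      then show False
        using odd_card_filter_neq[OF finite_cycle[OF C(1)], of P "\<lambda>f. odd (card (f \<inter> X))"]
          assms(4)[OF C(1)] even_card_cycle_cut[OF C(1), of X] by simp
    qed
    have "a \<in> K" by (simp add: K_def path_component_refl)
    have toggle: "odd (card (f \<inter> sym_diff X K)) \<longleftrightarrow>
        (odd (card (f \<inter> X)) \<noteq> odd (card (f \<inter> K)))" if "card f = 2" for f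
      using that by (intro odd_card_Int_sym_diff) (auto intro: card_ge_0_finite)
    have "P f \<longleftrightarrow> odd (card (f \<inter> sym_diff X K))" if f: "f \<in> insert e E" for f
    proof (cases "f = e")
      case True
      have "odd (card (e \<inter> K))"
        using \<open>a \<in> K\<close> \<open>b \<notin> K\<close> e by (simp add: odd_card_doubleton_Int)
      then show ?thesis using True False toggle[of e] insert.prems(1) by auto
    next
      case False
      then have fE: "f \<in> E" and f2: "card f = 2" using f insert.prems(1) by auto
      obtain v w where vw: "f = {v, w}" "v \<noteq> w" using f2 by (auto simp: card_2_iff)
      have "v \<in> K \<longleftrightarrow> w \<in> K"
        using path_component_step[of v E a w] path_component_step[of w E a v] fE vw
        by (auto simp: K_def insert_commute)
      then have "even (card (f \<inter> K))" using odd_card_doubleton_Int[OF vw(2), of K] vw(1) by simp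
      then show ?thesis using X[OF fE] toggle[OF f2] by simp
    qed
    then show ?thesis by blast
  qed
qed simp

section \<open>Colourings that differ by a cut\<close>

definition differ_by_cut :: "'a ec_graph \<Rightarrow> 'a ec_graph \<Rightarrow> 'a set \<Rightarrow> bool" where
  "differ_by_cut G H X \<longleftrightarrow>
     (\<forall>e\<in>edges (underlying G).
        (even (colour G e) \<noteq> even (colour H e)) \<longleftrightarrow> odd (card (e \<inter> X)))"

lemma edge_colouredD:
  assumes "edge_coloured m G"
  shows "finite (edges (underlying G))"
    and "\<And>e. e \<in> edges (underlying G) \<Longrightarrow> card e = 2"
    and "\<And>e. e \<in> edges (underlying G) \<Longrightarrow> e \<subseteq> verts (underlying G)"
    and "\<And>e. e \<in> edges (underlying G) \<Longrightarrow> finite e"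
    and "\<And>e. e \<in> edges (underlying G) \<Longrightarrow> colour G e \<in> {1..m}"
proof -
  have *: "finite (verts (underlying G))"
    "\<And>e. e \<in> edges (underlying G) \<Longrightarrow> e \<subseteq> verts (underlying G)"
    using assms by (auto simp: edge_coloured_def simple_graph_def)
  then show "finite (edges (underlying G))"
    by (meson PowI finite_Pow_iff finite_subset subsetI)
  show "\<And>e. e \<in> edges (underlying G) \<Longrightarrow> e \<subseteq> verts (underlying G)"
       "\<And>e. e \<in> edges (underlying G) \<Longrightarrow> finite e"
    using * by (auto intro: finite_subset)
  show "\<And>e. e \<in> edges (underlying G) \<Longrightarrow> card e = 2"
    "\<And>e. e \<in> edges (underlying G) \<Longrightarrow> colour G e \<in> {1..m}"
    using assms by (auto simp: edge_coloured_def simple_graph_def)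
qed

lemma in_odd_cycles_iff:
  assumes "edge_coloured m G"
  shows "C \<in> odd_cycles m G \<longleftrightarrow>
     is_cycle (underlying G) C \<and> odd (card {e \<in> C. even (colour G e)})"
proof -
  have "{e \<in> C. colour G e \<in> even_colours m} = {e \<in> C. even (colour G e)}"
    if "is_cycle (underlying G) C"
    using that edge_colouredD(5)[OF assms] unfolding is_cycle_def even_colours_def by blast
  then show ?thesis by (auto simp: odd_cycles_def)
qed

text \<open>
  On each cycle, the two counts of even colours have the same parity exactly if the number of edges
  on which the parities of the colours differ is even. The balance theorem turns this condition,
  imposed on all cycles, into the existence of a cut.
\<close>

lemma odd_cycles_eq_iff_cut:
  assumes "edge_coloured m G" "edge_coloured m H" "underlying G = underlying H"
  shows "odd_cycles m G = odd_cycles m H \<longleftrightarrow> (\<exists>X. differ_by_cut G H X)"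
proof -
  let ?F = "underlying G"
  let ?P = "\<lambda>e. even (colour G e) \<noteq> even (colour H e)"
  have "odd_cycles m G = odd_cycles m H \<longleftrightarrow>
        (\<forall>C. is_cycle ?F C \<longrightarrow> (odd (card {e \<in> C. even (colour G e)}) \<longleftrightarrow>
                                odd (card {e \<in> C. even (colour H e)})))"
    using in_odd_cycles_iff[OF assms(1)] in_odd_cycles_iff[OF assms(2)] assms(3)
    by (auto simp: set_eq_iff)
  also have "\<dots> \<longleftrightarrow> (\<forall>C. is_cycle ?F C \<longrightarrow> even (card {e \<in> C. ?P e}))"
    using odd_card_filter_neq[OF finite_cycle,
        of ?F _ "\<lambda>e. even (colour G e)" "\<lambda>e. even (colour H e)"] by auto
  also have "\<dots> \<longleftrightarrow> (\<exists>X. differ_by_cut G H X)"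
  proof
    assume "\<forall>C. is_cycle ?F C \<longrightarrow> even (card {e \<in> C. ?P e})"
    then show "\<exists>X. differ_by_cut G H X"
      unfolding differ_by_cut_def
      using balanced_imp_cut[OF edge_colouredD(1,2)[OF assms(1)] subset_refl, of ?P] by blast
  next
    assume "\<exists>X. differ_by_cut G H X"
    then obtain X where X: "differ_by_cut G H X" ..
    show "\<forall>C. is_cycle ?F C \<longrightarrow> even (card {e \<in> C. ?P e})"
    proof (intro allI impI)
      fix C assume C: "is_cycle ?F C"
      then have "{e \<in> C. ?P e} = {e \<in> C. odd (card (e \<inter> X))}"
        using X unfolding differ_by_cut_def is_cycle_def by blast
      then show "even (card {e \<in> C. ?P e})" using even_card_cycle_cut[OF C] by simp
    qed
  qed
  finally show ?thesis .
qed

section \<open>The dihedral group and parity\<close>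

lemma dist_cis: "(dist (cis a) (cis b))\<^sup>2 = 2 - 2 * cos (a - b)"
proof -
  have "(dist (cis a) (cis b))\<^sup>2 = (cos a - cos b)\<^sup>2 + (sin a - sin b)\<^sup>2"
    by (simp add: dist_norm cmod_power2)
  also have "\<dots> = ((sin a)\<^sup>2 + (cos a)\<^sup>2) + ((sin b)\<^sup>2 + (cos b)\<^sup>2)
      - 2 * (cos a * cos b + sin a * sin b)"
    by (simp add: power2_eq_square algebra_simps)
  finally show ?thesis by (simp add: cos_diff)
qed

lemma dist_polygon_vertex:
  "(dist (polygon_vertex m i) (polygon_vertex m j))\<^sup>2 =
     2 - 2 * cos (2 * pi * (real i - real j) / real m)"
  unfolding polygon_vertex_def dist_cis by (simp add: algebra_simps diff_divide_distrib)

lemma cos_eq_imp: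
  assumes "cos x = cos (y::real)"
  shows "\<exists>k::int. x = y + 2 * pi * of_int k \<or> x = - y + 2 * pi * of_int k"
proof -
  have "sin ((x + y) / 2) * sin ((y - x) / 2) = 0"
    using assms cos_diff_cos[of x y] by simp
  then consider "sin ((x + y) / 2) = 0" | "sin ((y - x) / 2) = 0" by auto
  then show ?thesis
  proof cases
    case 1
    then obtain k :: int where "(x + y) / 2 = of_int k * pi" by (auto simp: sin_zero_iff_int2)
    then have "x = - y + 2 * pi * of_int k" by (simp add: field_simps)
    then show ?thesis by blast
  next
    case 2
    then obtain k :: int where "(y - x) / 2 = of_int k * pi" by (auto simp: sin_zero_iff_int2)
    then have "x = y + 2 * pi * of_int (- k)" by (simp add: field_simps)
    then show ?thesis by blast
  qed
qed

text \<open>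
  Two vertices at the distance of neighbours are neighbours: by the cosine formula their numbers
  differ by \<open>1\<close> or \<open>-1\<close> modulo \<open>m\<close>, hence by an odd number as \<open>m\<close> is even.
\<close>

lemma adjacent_polygon_vertices_parity:
  assumes "m > 0" "even m"
    and "dist (polygon_vertex m i) (polygon_vertex m j) =
         dist (polygon_vertex m k) (polygon_vertex m (Suc k))"
  shows "even i \<noteq> even j"
proof -
  have "cos (2 * pi * (real i - real j) / real m) = cos (2 * pi * (real k - real (Suc k)) / real m)"
    using assms(3) dist_polygon_vertex by (metis diff_left_imp_eq mult_left_cancel zero_neq_numeral)
  also have "\<dots> = cos (2 * pi / real m)"
    by (simp add: algebra_simps)
  finally obtain l :: int where
    l: "2 * pi * (real i - real j) / real m = 2 * pi / real m + 2 * pi * of_int l \<or>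
        2 * pi * (real i - real j) / real m = - (2 * pi / real m) + 2 * pi * of_int l"
    using cos_eq_imp by blast
  have "real i - real j = 1 + of_int l * real m \<or> real i - real j = - 1 + of_int l * real m"
    using l
  proof (rule disj_forward)
    assume "2 * pi * (real i - real j) / real m = 2 * pi / real m + 2 * pi * of_int l"
    then have "(2 * pi) * (real i - real j) = (2 * pi) * (1 + of_int l * real m)"
      using assms(1) by (simp add: field_simps)
    then show "real i - real j = 1 + of_int l * real m" by simp
  next
    assume "2 * pi * (real i - real j) / real m = - (2 * pi / real m) + 2 * pi * of_int l"
    then have "(2 * pi) * (real i - real j) = (2 * pi) * (- 1 + of_int l * real m)"
      using assms(1) by (simp add: field_simps)
    then show "real i - real j = - 1 + of_int l * real m" by simp
  qed
  then have "real_of_int (int i - int j) = of_int (1 + l * int m) \<or>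
             real_of_int (int i - int j) = of_int (- 1 + l * int m)" by simp
  then have "int i - int j = 1 + l * int m \<or> int i - int j = - 1 + l * int m"
    by (simp only: of_int_eq_iff)
  moreover have "even (l * int m)" using assms(2) by simp
  ultimately have "odd (int i - int j)" by presburger
  then show ?thesis by simp
qed

lemma D_permutes: "\<pi> \<in> D m \<Longrightarrow> \<pi> permutes {1..m}"
  by (auto simp: D_def split: if_splits)

lemma D_adjacent_parity:
  assumes "even m" "\<pi> \<in> D m" "i \<in> {1..<m}"
  shows "even (\<pi> i) \<noteq> even (\<pi> (Suc i))"
proof (cases "m = 2")
  case True
  then have "\<pi> permutes {1..2}" and i: "i = 1" using D_permutes[OF assms(2)] assms(3) by auto
  have "\<pi> 1 \<in> {1..2}" "\<pi> 2 \<in> {1..2}"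
    using permutes_in_image[OF \<open>\<pi> permutes {1..2}\<close>] by simp_all
  moreover have "\<pi> 1 \<noteq> \<pi> 2"
    using permutes_inj[OF \<open>\<pi> permutes {1..2}\<close>] by (simp add: inj_eq)
  ultimately have "\<pi> 1 = 1 \<and> \<pi> 2 = 2 \<or> \<pi> 1 = 2 \<and> \<pi> 2 = 1"
    unfolding atLeastAtMost_iff by linarith
  then have "even (\<pi> 1) \<noteq> even (\<pi> 2)" by auto
  then show ?thesis using i by (simp add: numeral_2_eq_2)
next
  case False
  then have "\<exists>f :: complex \<Rightarrow> complex. (\<forall>z w. dist (f z) (f w) = dist z w) \<and>
      (\<forall>i\<in>{1..m}. f (polygon_vertex m i) = polygon_vertex m (\<pi> i))"
    using assms(2) by (simp add: D_def)
  then obtain f :: "complex \<Rightarrow> complex" where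
    f: "\<And>z w. dist (f z) (f w) = dist z w"
      "\<And>i. i \<in> {1..m} \<Longrightarrow> f (polygon_vertex m i) = polygon_vertex m (\<pi> i)"
    by blast
  have "i \<in> {1..m}" "Suc i \<in> {1..m}" "m > 0" using assms(3) by auto
  then have "dist (polygon_vertex m (\<pi> i)) (polygon_vertex m (\<pi> (Suc i))) =
        dist (polygon_vertex m i) (polygon_vertex m (Suc i))"
    by (simp only: f(2)[symmetric] f(1))
  then show ?thesis
    by (rule adjacent_polygon_vertices_parity[OF \<open>m > 0\<close> assms(1)])
qed

text \<open>
  Both \<open>i\<close> and \<open>\<pi> i\<close> change parity when \<open>i\<close> is increased by one, so whether they agree is decided
  at \<open>i = 1\<close>.
\<close>

lemma D_parity:
  assumes "even m" "\<pi> \<in> D m"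
  shows "(\<forall>i\<in>{1..m}. even (\<pi> i) = even i) \<or> (\<forall>i\<in>{1..m}. even (\<pi> i) \<noteq> even i)"
proof -
  have "(even (\<pi> i) = even i) = odd (\<pi> 1)" if "i \<ge> 1" "i \<le> m" for i
    using that
  proof (induction i rule: nat_induct_at_least)
    case (Suc i)
    then show ?case using D_adjacent_parity[OF assms, of i] by auto
  qed simp
  then show ?thesis by auto
qed

text \<open>
  The two reflections \<open>i \<mapsto> 1 - i\<close> and \<open>i \<mapsto> - i\<close> modulo \<open>m\<close>, with representatives in \<open>{1..m}\<close>. They are
  named after the residue of \<open>i + \<pi> i\<close>, so for even \<open>m\<close> the first reverses parities and the second
  preserves them. Their axes are neighbouring, and their composition is the rotation by one step.
\<close>

definition reflect_odd :: "nat \<Rightarrow> nat \<Rightarrow> nat" where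
  "reflect_odd m i = (if i \<in> {1..m} then m + 1 - i else i)"

definition reflect_even :: "nat \<Rightarrow> nat \<Rightarrow> nat" where
  "reflect_even m i = (if i \<in> {1..<m} then m - i else i)"

text \<open>
  The isometry is \<open>z \<mapsto> v\<^sub>k * cnj z\<close>, where \<open>v\<^sub>k\<close> is the \<open>k\<close>-th vertex: it sends vertex \<open>i\<close> to the
  vertex numbered \<open>k - i\<close> modulo \<open>m\<close>.
\<close>

lemma reflection_in_D:
  assumes "m > 0" "\<pi> permutes {1..m}"
    and "\<And>i. i \<in> {1..m} \<Longrightarrow> \<pi> i + i = k \<or> \<pi> i + i = k + m"
  shows "\<pi> \<in> D m"
proof (cases "m = 2")
  case True
  then show ?thesis using assms(2) by (simp add: D_def)
next
  case False
  define f where "f z = polygon_vertex m k * cnj z" for z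
  have "dist (f z) (f w) = dist z w" for z w
  proof -
    have "f z - f w = polygon_vertex m k * cnj (z - w)" by (simp add: f_def algebra_simps)
    then show ?thesis
      by (simp only: dist_norm norm_mult complex_mod_cnj) (simp add: polygon_vertex_def)
  qed
  moreover have "f (polygon_vertex m i) = polygon_vertex m (\<pi> i)" if "i \<in> {1..m}" for i
  proof -
    have v: "f (polygon_vertex m i) = cis (2 * pi * (real k - real i) / real m)"
      by (simp add: f_def polygon_vertex_def cis_mult cis_cnj algebra_simps diff_divide_distrib)
    from assms(3)[OF that] show ?thesis
    proof
      assume "\<pi> i + i = k"
      then have "real k - real i = real (\<pi> i)" by auto
      then show ?thesis by (simp only: v) (simp add: polygon_vertex_def)
    next
      assume "\<pi> i + i = k + m"
      then have "real (\<pi> i) + real i = real k + real m" by (metis of_nat_add)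
      then have "real (\<pi> i) = (real k - real i) + real m" by simp
      then have "2 * pi * real (\<pi> i) / real m = 2 * pi * (real k - real i) / real m + 2 * pi"
        using assms(1) by (simp only: distrib_left add_divide_distrib) simp
      then have "polygon_vertex m (\<pi> i) =
          cis (2 * pi * (real k - real i) / real m) * cis (2 * pi)"
        unfolding polygon_vertex_def by (simp only: cis_mult)
      then show ?thesis by (simp only: v) simp
    qed
  qed
  ultimately have "\<exists>f :: complex \<Rightarrow> complex. (\<forall>z w. dist (f z) (f w) = dist z w) \<and>
      (\<forall>i\<in>{1..m}. f (polygon_vertex m i) = polygon_vertex m (\<pi> i))" by blast
  then show ?thesis using False assms(2) by (simp add: D_def)
qed

lemma reflect_odd_involution [simp]: "reflect_odd m (reflect_odd m i) = i"
  by (auto simp: reflect_odd_def)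

lemma reflect_even_involution [simp]: "reflect_even m (reflect_even m i) = i"
  by (auto simp: reflect_even_def)

lemma involution_permutes:
  assumes "\<And>i. \<pi> (\<pi> i) = i" "\<And>i. i \<notin> S \<Longrightarrow> \<pi> i = i"
  shows "\<pi> permutes S"
  unfolding permutes_def using assms by metis

lemma reflect_odd_in_D: "m > 0 \<Longrightarrow> reflect_odd m \<in> D m"
  by (rule reflection_in_D[where k = 1], simp, rule involution_permutes)
    (auto simp: reflect_odd_def)

lemma reflect_even_in_D: "m > 0 \<Longrightarrow> reflect_even m \<in> D m"
  by (rule reflection_in_D[where k = m], simp, rule involution_permutes)
    (auto simp: reflect_even_def)

lemma even_reflect_odd: "even m \<Longrightarrow> i \<in> {1..m} \<Longrightarrow> even (reflect_odd m i) \<noteq> even i"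
  by (auto simp: reflect_odd_def)

definition rotate_colour :: "nat \<Rightarrow> nat \<Rightarrow> nat" where
  "rotate_colour m i = reflect_odd m (reflect_even m i)"

lemma rotate_colour_funpow:
  assumes "i \<in> {1..m}"
  shows "(rotate_colour m ^^ k) i = (i - 1 + k) mod m + 1"
proof (induction k)
  case 0
  have "i - 1 < m" using assms by auto
  then show ?case using assms by simp
next
  case (Suc k)
  have "(i - 1 + k) mod m < m" using assms by simp
  then have "rotate_colour m ((i - 1 + k) mod m + 1) = Suc ((i - 1 + k) mod m) mod m + 1"
    by (auto simp: rotate_colour_def reflect_odd_def reflect_even_def mod_Suc)
  then show ?case using Suc by (simp add: mod_Suc_eq)
qed

lemma double_rotation_transitive:
  assumes "even m" "i \<in> {1..m}" "j \<in> {1..m}" "even i = even j"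
  obtains n where "((rotate_colour m ^^ 2) ^^ n) i = j"
proof -
  \<comment> \<open>The summand \<open>m\<close> keeps the number of steps nonnegative; it is even, so \<open>k\<close> is even too.\<close>
  define k where "k = m + j - i"
  have "even k" using assms by (auto simp: k_def)
  then obtain n where n: "k = 2 * n" by blast
  have "i - 1 + k = (j - 1) + m" using assms by (auto simp: k_def)
  moreover have "j - 1 < m" "j - 1 + 1 = j" using assms(3) by auto
  ultimately have "(rotate_colour m ^^ k) i = j"
    by (simp only: rotate_colour_funpow[OF assms(2)] mod_add_self2 mod_less)
  then show thesis using that n by (metis funpow_mult)
qed

section \<open>Switching\<close>

lemma underlying_switch [simp]: "underlying (switch s G) = underlying G"
  by (cases s) (simp add: switch_def)

lemma colour_switch [simp]:
  "colour (switch (x, \<pi>) G) e = (if x \<in> e then \<pi> (colour G e) else colour G e)"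
  by (simp add: switch_def)

lemma switches_Nil [simp]: "switches G [] = G"
  and switches_Cons [simp]: "switches G (s # S) = switches (switch s G) S"
  and switches_append [simp]: "switches G (S @ T) = switches (switches G S) T"
  by (simp_all add: switches_def)

lemma underlying_switches [simp]: "underlying (switches G S) = underlying G"
  by (induction S arbitrary: G) auto

lemma edge_coloured_switch:
  assumes "edge_coloured m G" "\<pi> \<in> D m"
  shows "edge_coloured m (switch (x, \<pi>) G)"
  using assms permutes_in_image[OF D_permutes[OF assms(2)]] by (auto simp: edge_coloured_def)

lemma edge_coloured_switches:
  assumes "edge_coloured m G" "switching_sequence m G S"
  shows "edge_coloured m (switches G S)"
  using assms
proof (induction S arbitrary: G)
  case (Cons s S)
  then show ?case
    using edge_coloured_switch[OF Cons.prems(1), of "snd s" "fst s"]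
    by (auto simp: switching_sequence_def)
qed simp

lemma differ_by_cut_trans:
  assumes "edge_coloured m G" "underlying G = underlying G'"
    and "differ_by_cut G G' X" "differ_by_cut G' H Y"
  shows "differ_by_cut G H (sym_diff X Y)"
  using assms(2-4) odd_card_Int_sym_diff[OF edge_colouredD(4)[OF assms(1)]]
  unfolding differ_by_cut_def by metis

text \<open>
  The cut is empty for a symmetry that preserves parities and the star of \<open>x\<close> for one that
  reverses them.
\<close>

lemma switch_differ_by_cut:
  assumes "even m" "edge_coloured m G" "\<pi> \<in> D m"
  shows "\<exists>X. differ_by_cut G (switch (x, \<pi>) G) X"
  using D_parity[OF assms(1,3)]
proof
  assume "\<forall>i\<in>{1..m}. even (\<pi> i) = even i"
  then have "differ_by_cut G (switch (x, \<pi>) G) {}"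
    using edge_colouredD(5)[OF assms(2)] by (simp add: differ_by_cut_def)
  then show ?thesis ..
next
  assume "\<forall>i\<in>{1..m}. even (\<pi> i) \<noteq> even i"
  then have "differ_by_cut G (switch (x, \<pi>) G) {x}"
    using edge_colouredD(5)[OF assms(2)] by (auto simp: differ_by_cut_def)
  then show ?thesis ..
qed

lemma switches_differ_by_cut:
  assumes "even m" "edge_coloured m G" "switching_sequence m G S"
  shows "\<exists>X. differ_by_cut G (switches G S) X"
  using assms(2,3)
proof (induction S arbitrary: G)
  case Nil
  have "differ_by_cut G G {}" by (simp add: differ_by_cut_def)
  then show ?case by auto
next
  case (Cons s S)
  obtain x \<pi> where s: "s = (x, \<pi>)" by fastforce
  have \<pi>: "\<pi> \<in> D m" and S: "switching_sequence m (switch s G) S"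
    using Cons.prems(2) by (auto simp: switching_sequence_def s)
  obtain X where "differ_by_cut G (switch s G) X"
    using switch_differ_by_cut[OF assms(1) Cons.prems(1) \<pi>] s by auto
  moreover obtain Y where "differ_by_cut (switch s G) (switches (switch s G) S) Y"
    using Cons.IH[OF _ S] edge_coloured_switch[OF Cons.prems(1) \<pi>] s by auto
  ultimately have "differ_by_cut G (switches (switch s G) S) (sym_diff X Y)"
    by (intro differ_by_cut_trans[OF Cons.prems(1)]) auto
  then show ?case by auto
qed

lemma realise_cut:
  assumes "even m" "m > 0" "edge_coloured m G" "finite X" "X \<subseteq> verts (underlying G)"
  shows "\<exists>S. switching_sequence m G S \<and> differ_by_cut G (switches G S) X"
  using assms(4,5)
proof (induction X)
  case empty
  have "differ_by_cut G G {}" by (simp add: differ_by_cut_def)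
  then show ?case by (intro exI[of _ "[]"]) (simp add: switching_sequence_def)
next
  case (insert x X)
  then obtain S where S: "switching_sequence m G S" "differ_by_cut G (switches G S) X" by auto
  let ?s = "(x, reflect_odd m)"
  have "differ_by_cut (switches G S) (switch ?s (switches G S)) {x}"
    using edge_colouredD(5)[OF edge_coloured_switches[OF assms(3) S(1)]] even_reflect_odd[OF assms(1)]
    by (auto simp: differ_by_cut_def simp del: underlying_switches)
  then have "differ_by_cut G (switches G (S @ [?s])) (sym_diff X {x})"
    using differ_by_cut_trans[OF assms(3) _ S(2)] by simp
  moreover have "sym_diff X {x} = insert x X" using insert.hyps by auto
  moreover have "switching_sequence m G (S @ [?s])"
    using S(1) insert.prems reflect_odd_in_D[OF assms(2)] by (simp add: switching_sequence_def)
  ultimately show ?case by metis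
qed

text \<open>
  The commutator trick. Each reflection is an involution, so an edge that meets only one of \<open>x\<close> and
  \<open>y\<close> recovers its colour, while the edge \<open>xy\<close> undergoes two rotations by one step.
\<close>

lemma rotate_edge_by_two:
  assumes "m > 0" "edge_coloured m G" "{x, y} \<in> edges (underlying G)"
  defines "S \<equiv> [(x, reflect_even m), (y, reflect_odd m), (x, reflect_even m), (y, reflect_odd m)]"
  shows "switching_sequence m G S"
    and "\<And>e. e \<in> edges (underlying G) \<Longrightarrow> colour (switches G S) e =
           (if e = {x, y} then (rotate_colour m ^^ 2) (colour G e) else colour G e)"
proof -
  show "switching_sequence m G S"
    using edge_colouredD(3)[OF assms(2,3)] reflect_odd_in_D[OF assms(1)]
      reflect_even_in_D[OF assms(1)] by (simp add: S_def switching_sequence_def)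
  fix e assume e: "e \<in> edges (underlying G)"
  have "x \<noteq> y" using edge_colouredD(2)[OF assms(2,3)] by auto
  then have "x \<in> e \<and> y \<in> e \<longleftrightarrow> e = {x, y}"
    using edge_colouredD(2)[OF assms(2) e] by (auto simp: card_2_iff)
  then show "colour (switches G S) e =
           (if e = {x, y} then (rotate_colour m ^^ 2) (colour G e) else colour G e)"
    by (auto simp: S_def rotate_colour_def numeral_2_eq_2)
qed

lemma rotate_edge_by_twice:
  assumes "m > 0" "edge_coloured m G" "{x, y} \<in> edges (underlying G)"
  shows "\<exists>S. switching_sequence m G S \<and> (\<forall>e\<in>edges (underlying G). colour (switches G S) e =
           (if e = {x, y} then ((rotate_colour m ^^ 2) ^^ n) (colour G e) else colour G e))"
proof (induction n)
  case 0
  show ?case by (intro exI[of _ "[]"]) (simp add: switching_sequence_def)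
next
  case (Suc n)
  then obtain S where S: "switching_sequence m G S"
    "\<And>e. e \<in> edges (underlying G) \<Longrightarrow> colour (switches G S) e =
       (if e = {x, y} then ((rotate_colour m ^^ 2) ^^ n) (colour G e) else colour G e)" by blast
  obtain T where T: "switching_sequence m (switches G S) T"
    "\<And>e. e \<in> edges (underlying G) \<Longrightarrow> colour (switches (switches G S) T) e =
       (if e = {x, y} then (rotate_colour m ^^ 2) (colour (switches G S) e)
        else colour (switches G S) e)"
    using rotate_edge_by_two[OF assms(1) edge_coloured_switches[OF assms(2) S(1)], of x y]
      assms(3) by (metis underlying_switches)
  have "switching_sequence m G (S @ T)"
    using T(1) S(1) by (simp add: switching_sequence_def)
  moreover have "colour (switches G (S @ T)) e =
       (if e = {x, y} then ((rotate_colour m ^^ 2) ^^ Suc n) (colour G e) else colour G e)"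
    if "e \<in> edges (underlying G)" for e
  proof (cases "e = {x, y}")
    case True
    then show ?thesis unfolding switches_append T(2)[OF that] S(2)[OF that] by simp
  next
    case False
    then show ?thesis unfolding switches_append T(2)[OF that] S(2)[OF that] by simp
  qed
  ultimately show ?case by blast
qed

text \<open>
  Repeating the commutator rotates the colour of \<open>e\<close> by two steps each time, which reaches every
  colour of its parity.
\<close>

lemma recolour_edge:
  assumes "even m" "edge_coloured m G" "e \<in> edges (underlying G)"
    and "c \<in> {1..m}" "even c = even (colour G e)"
  shows "\<exists>S. switching_sequence m G S \<and> (\<forall>f\<in>edges (underlying G).
           colour (switches G S) f = (if f = e then c else colour G f))"
proof -
  obtain x y where e: "e = {x, y}"
    using edge_colouredD(2)[OF assms(2,3)] by (auto simp: card_2_iff)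
  obtain n where n: "((rotate_colour m ^^ 2) ^^ n) (colour G e) = c"
    using double_rotation_transitive[OF assms(1) edge_colouredD(5)[OF assms(2,3)] assms(4)]
      assms(5) by auto
  have "m > 0" using assms(4) by simp
  then obtain S where "switching_sequence m G S"
    "\<forall>f\<in>edges (underlying G). colour (switches G S) f =
       (if f = e then ((rotate_colour m ^^ 2) ^^ n) (colour G f) else colour G f)"
    using rotate_edge_by_twice[OF _ assms(2), of x y n] assms(3) e by auto
  then show ?thesis using n by (intro exI[of _ S]) auto
qed

lemma equal_parities_imp_switches:
  assumes "even m" "edge_coloured m G" "edge_coloured m H" "underlying G = underlying H"
    and par: "\<And>e. e \<in> edges (underlying G) \<Longrightarrow> even (colour G e) = even (colour H e)"
  shows "\<exists>S. switching_sequence m G S \<and>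
           (\<forall>e\<in>edges (underlying G). colour (switches G S) e = colour H e)"
proof -
  have "\<exists>S. switching_sequence m G S \<and> (\<forall>e\<in>edges (underlying G).
          colour (switches G S) e = (if e \<in> A then colour H e else colour G e))"
    if "finite A" "A \<subseteq> edges (underlying G)" for A
    using that
  proof (induction A)
    case empty
    show ?case by (intro exI[of _ "[]"]) (simp add: switching_sequence_def)
  next
    case (insert a A)
    then obtain S where S: "switching_sequence m G S"
      "\<And>e. e \<in> edges (underlying G) \<Longrightarrow>
         colour (switches G S) e = (if e \<in> A then colour H e else colour G e)" by blast
    have a: "a \<in> edges (underlying G)" using insert.prems by simp
    have "even (colour H a) = even (colour (switches G S) a)"
      using S(2)[OF a] par[OF a] by simp
    then obtain T where T: "switching_sequence m (switches G S) T"
      "\<And>f. f \<in> edges (underlying G) \<Longrightarrow> colour (switches (switches G S) T) f =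
         (if f = a then colour H a else colour (switches G S) f)"
      using recolour_edge[OF assms(1) edge_coloured_switches[OF assms(2) S(1)], of a "colour H a"]
        a edge_colouredD(5)[OF assms(3)] assms(4) by (metis underlying_switches)
    have "switching_sequence m G (S @ T)"
      using S(1) T(1) by (simp add: switching_sequence_def)
    then show ?case using S(2) T(2) by (intro exI[of _ "S @ T"]) auto
  qed
  from this[OF edge_colouredD(1)[OF assms(2)] subset_refl] show ?thesis by auto
qed

lemma labelled_switch_equivalent_iff:
  assumes "underlying G = underlying H"
  shows "labelled_switch_equivalent m G H \<longleftrightarrow> (\<exists>S. switching_sequence m G S \<and>
           (\<forall>e\<in>edges (underlying G). colour (switches G S) e = colour H e))"
  using assms
  by (auto simp: labelled_switch_equivalent_def ec_iso_def graph_iso_def)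

text \<open>
  Given a cut, switching first corrects all parities, and then the edges are recoloured one by one.
  Switches are possible only at vertices of the graph, so \<open>X\<close> is first restricted to these.
\<close>

lemma labelled_switch_equivalent_iff_cut:
  assumes "even m" "m > 0" "edge_coloured m G" "edge_coloured m H" "underlying G = underlying H"
  shows "labelled_switch_equivalent m G H \<longleftrightarrow> (\<exists>X. differ_by_cut G H X)"
proof
  assume "labelled_switch_equivalent m G H"
  then obtain S where S: "switching_sequence m G S"
    "\<forall>e\<in>edges (underlying G). colour (switches G S) e = colour H e"
    using labelled_switch_equivalent_iff[OF assms(5)] by blast
  then show "\<exists>X. differ_by_cut G H X"
    using switches_differ_by_cut[OF assms(1,3) S(1)] by (simp add: differ_by_cut_def)
next
  let ?V = "verts (underlying G)"
  assume "\<exists>X. differ_by_cut G H X"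
  then obtain X where X: "differ_by_cut G H X" ..
  have fin: "finite (X \<inter> ?V)" using assms(3) by (simp add: edge_coloured_def simple_graph_def)
  obtain S where S: "switching_sequence m G S" "differ_by_cut G (switches G S) (X \<inter> ?V)"
    using realise_cut[OF assms(1-3) fin] by auto
  have "even (colour (switches G S) e) = even (colour H e)" if "e \<in> edges (underlying G)" for e
  proof -
    have "e \<inter> (X \<inter> ?V) = e \<inter> X" using edge_colouredD(3)[OF assms(3) that] by auto
    then show ?thesis using X S(2) that unfolding differ_by_cut_def by metis
  qed
  then obtain T where T: "switching_sequence m (switches G S) T"
    "\<forall>e\<in>edges (underlying G). colour (switches (switches G S) T) e = colour H e"
    using equal_parities_imp_switches[OF assms(1) edge_coloured_switches[OF assms(3) S(1)] assms(4)]
      assms(5) by auto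
  have "switching_sequence m G (S @ T)"
    using S(1) T(1) by (simp add: switching_sequence_def)
  then show "labelled_switch_equivalent m G H"
    using T(2) labelled_switch_equivalent_iff[OF assms(5)]
    by (metis switches_append)
qed

section \<open>Isomorphisms\<close>

lemma graph_iso_id: "graph_iso id F F"
  by (simp add: graph_iso_def)

lemma graph_iso_edge:
  assumes "graph_iso f F F'" "simple_graph F" "e \<in> edges F"
  shows "f ` e \<in> edges F'"
proof -
  obtain x y where "e = {x, y}" "x \<in> verts F" "y \<in> verts F"
    using assms(2,3) by (auto simp: simple_graph_def card_2_iff)
  then show ?thesis using assms(1,3) by (auto simp: graph_iso_def)
qed

lemma graph_iso_inv:
  assumes "graph_iso f F F'"
  shows "graph_iso (inv_into (verts F) f) F' F"
proof -
  let ?g = "inv_into (verts F) f"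
  have bij: "bij_betw f (verts F) (verts F')" using assms by (simp add: graph_iso_def)
  have g: "?g x \<in> verts F" "f (?g x) = x" if "x \<in> verts F'" for x
    using that bij by (auto simp: bij_betw_def inv_into_into f_inv_into_f)
  show ?thesis
    using assms g bij_betw_inv_into[OF bij] unfolding graph_iso_def by (metis)
qed

lemma map_cycle_inv_into:
  assumes "C \<subseteq> edges F'" "simple_graph F'" "graph_iso f F F'"
  shows "map_cycle f (map_cycle (inv_into (verts F) f) C) = C"
proof -
  have "f ` inv_into (verts F) f ` e = e" if "e \<in> C" for e
    using that assms by (intro image_inv_into_cancel[where A = "verts F" and A' = "verts F'"])
      (auto simp: graph_iso_def bij_betw_def simple_graph_def)
  then have "(\<lambda>e. f ` inv_into (verts F) f ` e) ` C = (\<lambda>e. e) ` C" by (rule image_cong[OF refl])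
  then show ?thesis by (simp add: map_cycle_def image_image)
qed

lemma ec_iso_inv:
  assumes "ec_iso f G H" "simple_graph (underlying G)" "simple_graph (underlying H)"
  shows "ec_iso (inv_into (verts (underlying G)) f) H G"
proof -
  let ?g = "inv_into (verts (underlying G)) f"
  have iso: "graph_iso f (underlying G) (underlying H)" using assms(1) by (simp add: ec_iso_def)
  have "colour G (?g ` e) = colour H e" if e: "e \<in> edges (underlying H)" for e
  proof -
    have "f ` ?g ` e = e"
      using map_cycle_inv_into[OF _ assms(3) iso, of "{e}"] e by (simp add: map_cycle_def)
    moreover have "?g ` e \<in> edges (underlying G)"
      using graph_iso_edge[OF graph_iso_inv[OF iso] assms(3) e] .
    ultimately show ?thesis using assms(1) unfolding ec_iso_def by metis
  qed
  then show ?thesis using graph_iso_inv[OF iso] by (simp add: ec_iso_def)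
qed

lemma inj_on_image_edges:
  assumes "graph_iso f F F'" "simple_graph F"
  shows "inj_on ((`) f) (edges F)"
proof -
  have "inj_on ((`) f) (Pow (verts F))"
    using assms(1) by (auto simp: graph_iso_def bij_betw_def intro: inj_on_image_Pow)
  then show ?thesis
    using assms(2) by (auto simp: simple_graph_def intro: inj_on_subset)
qed

lemma inj_on_map_cycle:
  assumes "graph_iso f F F'" "simple_graph F"
  shows "inj_on (map_cycle f) {C. is_cycle F C}"
proof -
  have "inj_on ((`) ((`) f)) (Pow (edges F))"
    using inj_on_image_edges[OF assms] by (rule inj_on_image_Pow)
  then have "inj_on (map_cycle f) (Pow (edges F))"
    by (simp add: map_cycle_def inj_on_def)
  then show ?thesis by (rule inj_on_subset) (auto simp: is_cycle_def)
qed

lemma is_cycle_map_cycle: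
  assumes "graph_iso f F F'" "simple_graph F" "is_cycle F C"
  shows "is_cycle F' (map_cycle f C)"
proof -
  obtain p where p: "distinct p" "length p \<ge> 3" "C = cycle_edges p" and CF: "C \<subseteq> edges F"
    using assms(3) by (auto simp: is_cycle_iff)
  have "set p \<subseteq> \<Union> C"
  proof
    fix v assume "v \<in> set p"
    then obtain i where i: "i < length p" "p ! i = v" by (auto simp: in_set_conv_nth)
    then have "{p ! i, p ! (Suc i mod length p)} \<in> C" by (auto simp: p(3) cycle_edges_def)
    then show "v \<in> \<Union> C" using i(2) by blast
  qed
  also have "\<dots> \<subseteq> verts F" using CF assms(2) by (auto simp: simple_graph_def)
  finally have "inj_on f (set p)"
    using assms(1) by (auto simp: graph_iso_def bij_betw_def intro: inj_on_subset)
  then have "distinct (map f p)" using p(1) by (simp add: distinct_map)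
  moreover have "map_cycle f C = cycle_edges (map f p)"
  proof -
    have "map_cycle f C = (\<lambda>i. f ` {p ! i, p ! (Suc i mod length p)}) ` {..<length p}"
      by (simp only: p(3) cycle_edges_image map_cycle_def image_image)
    also have "\<dots> = (\<lambda>i. {map f p ! i, map f p ! (Suc i mod length p)}) ` {..<length p}"
    proof (rule image_cong[OF refl])
      fix i assume "i \<in> {..<length p}"
      moreover from this have "Suc i mod length p < length p" by (intro mod_less_divisor) auto
      ultimately show "f ` {p ! i, p ! (Suc i mod length p)} =
          {map f p ! i, map f p ! (Suc i mod length p)}" by simp
    qed
    also have "\<dots> = cycle_edges (map f p)" by (simp add: cycle_edges_image)
    finally show ?thesis .
  qed
  moreover have "map_cycle f C \<subseteq> edges F'"
    using graph_iso_edge[OF assms(1,2)] CF by (auto simp: map_cycle_def)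
  ultimately show ?thesis using p(2) by (auto simp: is_cycle_iff)
qed

lemma map_cycle_odd_cycles_subset:
  assumes "ec_iso f G H" "simple_graph (underlying G)"
  shows "map_cycle f ` odd_cycles m G \<subseteq> odd_cycles m H"
proof
  fix C' assume "C' \<in> map_cycle f ` odd_cycles m G"
  then obtain C where C: "C \<in> odd_cycles m G" "C' = map_cycle f C" by blast
  have iso: "graph_iso f (underlying G) (underlying H)"
    and col: "\<And>e. e \<in> edges (underlying G) \<Longrightarrow> colour H (f ` e) = colour G e"
    using assms(1) by (auto simp: ec_iso_def)
  have cyc: "is_cycle (underlying G) C"
    and odd: "odd (card {e \<in> C. colour G e \<in> even_colours m})"
    using C(1) by (auto simp: odd_cycles_def)
  have CF: "C \<subseteq> edges (underlying G)" using cyc by (simp add: is_cycle_def)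
  have "{e \<in> C'. colour H e \<in> even_colours m} = (`) f ` {e \<in> C. colour G e \<in> even_colours m}"
    using CF col by (fastforce simp: C(2) map_cycle_def)
  moreover have "inj_on ((`) f) {e \<in> C. colour G e \<in> even_colours m}"
    using inj_on_image_edges[OF iso assms(2)] CF by (auto intro: inj_on_subset)
  ultimately have "odd (card {e \<in> C'. colour H e \<in> even_colours m})"
    using odd by (simp add: card_image)
  then show "C' \<in> odd_cycles m H"
    using is_cycle_map_cycle[OF iso assms(2) cyc] C(2) by (simp add: odd_cycles_def)
qed

text \<open>
  One inclusion for \<open>f\<close> and one for its inverse.
\<close>

lemma map_cycle_odd_cycles:
  assumes "ec_iso f G H" "simple_graph (underlying G)" "simple_graph (underlying H)"
  shows "map_cycle f ` odd_cycles m G = odd_cycles m H"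
proof
  show "map_cycle f ` odd_cycles m G \<subseteq> odd_cycles m H"
    using map_cycle_odd_cycles_subset assms by blast
  let ?g = "inv_into (verts (underlying G)) f"
  have g: "map_cycle ?g ` odd_cycles m H \<subseteq> odd_cycles m G"
    using map_cycle_odd_cycles_subset[OF ec_iso_inv[OF assms] assms(3)] .
  show "odd_cycles m H \<subseteq> map_cycle f ` odd_cycles m G"
  proof
    fix C assume C: "C \<in> odd_cycles m H"
    then have "map_cycle f (map_cycle ?g C) = C"
      using assms by (intro map_cycle_inv_into)
        (auto simp: odd_cycles_def is_cycle_def ec_iso_def)
    then show "C \<in> map_cycle f ` odd_cycles m G" using g C by (metis image_eqI image_subset_iff)
  qed
qed

text \<open>
  The colouring for which \<open>f\<close> becomes an isomorphism of edge-coloured graphs onto \<open>H\<close>. An isomorphism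
  from a switched \<open>G\<close> onto \<open>H\<close> is the same as an equality on edges with this colouring.
\<close>

definition pull_back :: "('a \<Rightarrow> 'b) \<Rightarrow> 'a graph \<Rightarrow> 'b ec_graph \<Rightarrow> 'a ec_graph" where
  "pull_back f F H = \<lparr>underlying = F, colour = (\<lambda>e. colour H (f ` e))\<rparr>"

lemma edge_coloured_pull_back:
  assumes "graph_iso f F (underlying H)" "simple_graph F" "edge_coloured m H"
  shows "edge_coloured m (pull_back f F H)"
  using graph_iso_edge[OF assms(1,2)] assms(2,3)
  by (simp add: edge_coloured_def pull_back_def)

lemma switch_equivalent_iff_pull_back:
  "switch_equivalent m G H \<longleftrightarrow> (\<exists>f. graph_iso f (underlying G) (underlying H) \<and>
     labelled_switch_equivalent m G (pull_back f (underlying G) H))"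
proof -
  have "ec_iso f (switches G S) H \<longleftrightarrow> graph_iso f (underlying G) (underlying H) \<and>
          ec_iso id (switches G S) (pull_back f (underlying G) H)" for f S
    by (simp add: ec_iso_def pull_back_def graph_iso_id)
  then show ?thesis
    unfolding switch_equivalent_def labelled_switch_equivalent_def by blast
qed

theorem corollary3p5:
  fixes m :: nat and G H :: "'a ec_graph"
  assumes "m \<ge> 2" and "even m"
    and "edge_coloured m G" and "edge_coloured m H"
    and "underlying G = underlying H"
  shows "(labelled_switch_equivalent m G H \<longleftrightarrow> odd_cycles m G = odd_cycles m H) \<and>
         (switch_equivalent m G H \<longleftrightarrow>
            (\<exists>f. graph_iso f (underlying G) (underlying H) \<and>
                 map_cycle f ` odd_cycles m G = odd_cycles m H))"
proof
  have labelled: "labelled_switch_equivalent m G K \<longleftrightarrow> odd_cycles m G = odd_cycles m K"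
    if "edge_coloured m K" "underlying G = underlying K" for K
    using labelled_switch_equivalent_iff_cut[OF assms(2) _ assms(3) that] assms(1)
      odd_cycles_eq_iff_cut[OF assms(3) that] by simp
  then show "labelled_switch_equivalent m G H \<longleftrightarrow> odd_cycles m G = odd_cycles m H"
    using assms(4,5) .
  have simple: "simple_graph (underlying G)" "simple_graph (underlying H)"
    using assms(3,4) by (auto simp: edge_coloured_def)
  have "labelled_switch_equivalent m G (pull_back f (underlying G) H) \<longleftrightarrow>
        map_cycle f ` odd_cycles m G = odd_cycles m H"
    if f: "graph_iso f (underlying G) (underlying H)" for f
  proof -
    let ?K = "pull_back f (underlying G) H"
    have "ec_iso f ?K H" using f by (simp add: ec_iso_def pull_back_def)
    then have "odd_cycles m H = map_cycle f ` odd_cycles m ?K"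
      using map_cycle_odd_cycles[of f ?K H m] simple by (simp add: pull_back_def)
    moreover have "map_cycle f ` odd_cycles m G = map_cycle f ` odd_cycles m ?K \<longleftrightarrow>
        odd_cycles m G = odd_cycles m ?K"
      using inj_on_map_cycle[OF f simple(1)]
      by (rule inj_on_image_eq_iff) (auto simp: odd_cycles_def pull_back_def)
    ultimately show ?thesis
      using labelled[OF edge_coloured_pull_back[OF f simple(1) assms(4)]]
      by (simp add: pull_back_def)
  qed
  then show "switch_equivalent m G H \<longleftrightarrow>
            (\<exists>f. graph_iso f (underlying G) (underlying H) \<and>
                 map_cycle f ` odd_cycles m G = odd_cycles m H)"
    unfolding switch_equivalent_iff_pull_back by blast
qed

end
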